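(* Let $f\colon\mathbb{R}^n\to\mathbb{R}$ be convex and twice continuously differentiable, let $x^\ast\in\mathbb{R}^n$ be a global minimizer of $f$, and put $f^\ast:=f(x^\ast)$. Let $p\in(1,3]$ and $x_0\in\mathbb{R}^n$, and let $\{x_k\}_{k\ge 0}$ be an infinite sequence generated from $x_0$ by the generalized regularized Newton method (GRNM) with exponent $p$ and parameters $\mu_k,\rho_k$ (see context), with $\nabla f(x_k)\neq 0$ for all $k\ge 0$. Suppose that: (A1) there exists $L>0$ such that for all $x,y\in\mathbb{R}^n$, $\|\nabla f(x)-\nabla f(y)-\nabla^2 f(y)(x-y)\|\le L\|x-y\|^2$ and $|f(x)-f(y)-\langle\nabla f(y),x-y\rangle-\frac12\langle\nabla^2 f(y)(x-y),x-y\rangle|\le\frac{L}{3}\|x-y\|^3$; (A2) for all $k\in\mathbb{N}\cup\{0\}$, $\mu_k=c_1^{\frac{p-1}{2}}\|\nabla f(x_k)\|^{\frac{3-p}{2}}$ and $\rho_k=\min\{\frac{q}{\sqrt n}\|\nabla f(x_k)\|,\;c_2\|\nabla f(x_k)\|^{\frac{p+1}{2}}\}$, where $c_1\ge L$, $c_2\in(0,1)$ and $q\ge0$; (A3) there exists $R>0$ such that $\{x\in\mathbb{R}^n: f(x)\le f(x_0)\}\subset B(0,R)$; (A4) $3-(1+q)^{\frac{3-p}{p-1}}>0$; (A5) $1+2q+(1+q)^{\frac{2}{p-1}}\ge 1$; (A6) there exist $\theta\in(q,1)$, $\nu>0$ and $\ell\in\mathbb{N}$ such that $\theta^k\le\nu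 k^{-2}$ and $\left(\left(1+2q+(1+q)^{\frac{2}{p-1}}\right)\theta\right)^{\frac k2}\le\nu k^{-2}$ for all $k\ge\ell$. Let $\mathcal{I}(\theta):=\{i\in\mathbb{N}\cup\{0\}:\theta\|\nabla f(x_i)\|\le\|\nabla f(x_{i+1})\|\}$, and let $$D:=R+\|x^\ast\|,\qquad \tau:=\frac{(\theta-q)^{\frac{p}{p-1}}\left(3-(1+q)^{\frac{3-p}{p-1}}\right)}{3\sqrt{c_1}\,D^{\frac32}\left(1+(1+q)^{\frac{3-p}{p-1}}\right)^{\frac{p}{p-1}}}.$$ Then $\{x_k\}$ satisfies one of the following statements: (a) If $|\mathcal{I}(\theta)|<\infty$, then $$f(x_k)-f^\ast\le\frac{\theta^{-(\hat i+1)}\,\nu D\,\|\nabla f(x_{\hat i+1})\|}{k^2}\qquad\text{for all }k\ge\max\{\ell,\hat i+2\},$$ where $\hat i$ is the largest element of $\mathcal{I}(\theta)$. (b) If $|\mathcal{I}(\theta)|=\infty$, then $$f(x_k)-f^\ast\le\max\left\{\frac{36\tau^{-2}}{(k+4)^2},\;\frac{\nu D\|\nabla f(x_0)\|}{k^2}\right\}\qquad\text{for all }k\ge\ell.$$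
   Context: $\mathbb{N}$ is the set of positive integers; $\|\cdot\|$ is the Euclidean norm on $\mathbb{R}^n$, $\|\cdot\|_1$ is the $L^1$ norm, $\langle\cdot,\cdot\rangle$ is the standard inner product; $B(\eta,r)=\{x:\|x-\eta\|\le r\}$ is the closed ball. GRNM: given a fixed exponent $p\in(1,3]$, a starting point $x_0$ and parameters $\mu_k>0$, $\rho_k\ge0$, at each iteration $k=0,1,2,\dots$ let $d_k$ be the global minimizer over $d\in\mathbb{R}^n$ of $$\varphi_k(d)=\langle\nabla f(x_k),d\rangle+\tfrac12\langle\nabla^2 f(x_k)d,d\rangle+\tfrac{\mu_k}{p}\|d\|^p+\rho_k\|d\|_1,$$ and set $x_{k+1}:=x_k+d_k$. *)

theory Defs
  imports "HOL-Analysis.Analysis"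
begin

definition gradient :: "(real ^ 'n \<Rightarrow> real) \<Rightarrow> real ^ 'n \<Rightarrow> real ^ 'n" where
  "gradient f x = (THE D. GDERIV f x :> D)"

definition hessian :: "(real ^ 'n \<Rightarrow> real) \<Rightarrow> real ^ 'n \<Rightarrow> real ^ 'n ^ 'n" where
  "hessian f x = jacobian (gradient f) (at x)"

definition C2 :: "(real ^ 'n \<Rightarrow> real) \<Rightarrow> bool" where
  "C2 f \<longleftrightarrow>
     (\<forall>x. f differentiable (at x)) \<and>
     (\<forall>x. gradient f differentiable (at x)) \<and>
     continuous_on UNIV (hessian f)"

lemma GDERIV_gradient:
  fixes f :: "real ^ 'n \<Rightarrow> real"
  assumes "f differentiable (at x)"
  shows "GDERIV f x :> gradient f x"
proof -
  obtain f' where f': "(f has_derivative f') (at x)"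
    using assms unfolding differentiable_def by blast
  then have lin: "linear f'"
    by (rule has_derivative_linear)
  define v where "v = adjoint f' 1"
  have "f' h = h \<bullet> v" for h
    using adjoint_works[OF lin, of h 1] by (simp add: v_def)
  then have "f' = (\<lambda>h. h \<bullet> v)"
    by blast
  with f' have D: "GDERIV f x :> v"
    by (simp add: gderiv_def)
  show ?thesis
    unfolding gradient_def
  proof (rule theI[where P = "\<lambda>D. GDERIV f x :> D", OF D])
    fix D' assume "GDERIV f x :> D'"
    then have "(\<lambda>h. h \<bullet> D') = (\<lambda>h. h \<bullet> v)"
      using D unfolding gderiv_def by (rule has_derivative_unique)
    then show "D' = v"
      by (metis vector_eq_ldot)
  qed
qed

lemma has_derivative_gradient:
  fixes f :: "real ^ 'n \<Rightarrow> real"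
  assumes "gradient f differentiable (at x)"
  shows "(gradient f has_derivative (\<lambda>h. hessian f x *v h)) (at x)"
  using iffD1[OF jacobian_works assms] unfolding hessian_def .

definition l1_norm :: "real ^ 'n \<Rightarrow> real" where
  "l1_norm d = (\<Sum>i\<in>UNIV. \<bar>d $ i\<bar>)"

definition grnm_model ::
  "(real ^ 'n \<Rightarrow> real) \<Rightarrow> real \<Rightarrow> real \<Rightarrow> real \<Rightarrow> real ^ 'n \<Rightarrow> real ^ 'n \<Rightarrow> real" where
  "grnm_model f p \<mu> \<rho> x d =
     gradient f x \<bullet> d + 1 / 2 * ((hessian f x *v d) \<bullet> d)
       + \<mu> / p * norm d powr p + \<rho> * l1_norm d"

definition grnm_sequence ::
  "(real ^ 'n \<Rightarrow> real) \<Rightarrow> real \<Rightarrow> (nat \<Rightarrow> real) \<Rightarrow> (nat \<Rightarrow> real) \<Rightarrow>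
     real ^ 'n \<Rightarrow> (nat \<Rightarrow> real ^ 'n) \<Rightarrow> bool" where
  "grnm_sequence f p \<mu> \<rho> x0 x \<longleftrightarrow>
     (\<forall>k. \<mu> k > 0 \<and> \<rho> k \<ge> 0) \<and> x 0 = x0 \<and>
     (\<exists>d. \<forall>k. is_arg_min (grnm_model f p (\<mu> k) (\<rho> k) (x k)) (\<lambda>_. True) (d k) \<and>
              x (Suc k) = x k + d k)"

text \<open>
  The index set \<open>I(\<theta>)\<close> may be finite because it is empty. Its largest element is then read as
  \<open>-1\<close>, so that the element after it is the starting index \<open>0\<close>; hence the type \<^typ>\<open>int\<close>.
\<close>
definition last_index :: "nat set \<Rightarrow> int" where
  "last_index I = (if I = {} then -1 else int (Max I))"

end

theory Submission
  imports Defs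
begin

text \<open>
  Write \<open>G\<^sub>k\<close> for the gradient norm and \<open>\<Delta>\<^sub>k\<close> for the optimality gap at \<open>x\<^sub>k\<close>. A step is fast
  if \<open>G\<^sub>k\<^sub>+\<^sub>1 < \<theta> G\<^sub>k\<close> and slow otherwise, and \<open>I\<close> is the set of slow steps. Three facts carry the proof.

  \<^item> Convexity and the bounded level set give \<open>\<Delta>\<^sub>k \<le> D G\<^sub>k\<close>, so small gradients mean small gaps.

  \<^item> No step increases \<open>f\<close>, and no step increases the gradient norm by more than the factor
    \<open>C = 1 + 2q + (1+q)\<^sup>2\<^sup>/\<^sup>(\<^sup>p\<^sup>-\<^sup>1\<^sup>)\<close>.

  \<^item> A slow step cannot be short: its length is bounded below in terms of \<open>G\<^sub>k\<close>, and then the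
    regularization term forces a decrease of \<open>f\<close> by at least \<open>\<tau> (D G\<^sub>k)\<^sup>3\<^sup>/\<^sup>2 \<ge> \<tau> \<Delta>\<^sub>k\<^sup>3\<^sup>/\<^sup>2\<close>.

  The last two facts are \<open>grnm_step\<close>. They come from the first-order conditions for the model
  minimizer \<open>d\<close> (\<open>model_minimizer_along_step\<close> and \<open>model_minimizer_residual\<close>): stationarity along
  \<open>d\<close>, and the bound \<open>\<parallel>v\<parallel> \<le> \<rho> \<surd>n \<le> q G\<^sub>k\<close> for the gradient \<open>v\<close> of the smooth part of the model at \<open>d\<close>. The
  scaling of \<open>\<mu>\<close> is such that the regularization dominates the Taylor error for every exponent
  \<open>p\<close> (\<open>regularized_step_length\<close>). The first-order conditions need a symmetric, positive
  semidefinite Hessian; both properties are read off from the Taylor estimates and convexity.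

  If there are finitely many slow steps, the gradients eventually decay like \<open>\<theta>\<^sup>k\<close>. Otherwise,
  count the slow steps before \<open>k\<close>. If at most half of the steps are slow, then
  \<open>G\<^sub>k \<le> (C \<theta>)\<^sup>k\<^sup>/\<^sup>2 G\<^sub>0\<close> (\<open>geometric_bound_by_count\<close>). If more than half are slow, then the recursion
  \<open>\<Delta>\<^sub>k - \<Delta>\<^sub>k\<^sub>+\<^sub>1 \<ge> \<tau> \<Delta>\<^sub>k\<^sup>3\<^sup>/\<^sup>2\<close> makes \<open>1/\<surd>\<Delta>\<^sub>k\<close> grow linearly (\<open>gap_bound_by_count\<close>).
\<close>

section \<open>Second-order Taylor estimates and convexity\<close>

lemma nonpos_if_le_small_multiples:
  fixes a C :: real
  assumes "\<And>t. 0 < t \<Longrightarrow> t < 1 \<Longrightarrow> a \<le> t * C"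
  shows "a \<le> 0"
proof (rule tendsto_lowerbound)
  show "((\<lambda>t. t * C) \<longlongrightarrow> 0) (at_right (0::real))"
    by (auto intro!: tendsto_eq_intros)
  show "\<forall>\<^sub>F t in at_right 0. a \<le> t * C"
    using assms by (auto simp: eventually_at_right_field intro!: exI[of _ 1])
qed simp

text \<open>
  Compare \<open>f (v + t h \<plusminus> t k)\<close> computed in two ways: expanded around \<open>v\<close>, and expanded around
  \<open>v + t h\<close> with the gradient there expanded around \<open>v\<close>. Subtracting the \<open>-\<close> case from the \<open>+\<close>
  case removes the unknown quadratic term at \<open>v + t h\<close>, and what is left at order \<open>t\<^sup>2\<close> is
  \<open>\<langle>H h, k\<rangle> - \<langle>H k, h\<rangle>\<close>. So symmetry follows from the two Taylor estimates.
\<close>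

lemma taylor_quadratic_term_symmetric:
  fixes f :: "real ^ 'n \<Rightarrow> real" and g :: "real ^ 'n \<Rightarrow> real ^ 'n" and H :: "real ^ 'n \<Rightarrow> real ^ 'n ^ 'n"
  assumes grad: "\<And>u v. norm (g u - g v - H v *v (u - v)) \<le> L * (norm (u - v))\<^sup>2"
    and taylor: "\<And>u v. \<bar>f u - f v - g v \<bullet> (u - v) - 1 / 2 * ((H v *v (u - v)) \<bullet> (u - v))\<bar>
                     \<le> L / 3 * norm (u - v) ^ 3"
  shows "(H v *v h) \<bullet> k = (H v *v k) \<bullet> h"
proof -
  have *: "(H v *v h) \<bullet> k - (H v *v k) \<bullet> h \<le> 0" for h k
  proof (rule nonpos_if_le_small_multiples)
    fix t :: real assume t: "0 < t" "t < 1"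
    define K where "K = 2 * (L / 3) * norm k ^ 3 + L / 3 * norm (h + k) ^ 3
       + L / 3 * norm (h - k) ^ 3 + 2 * (L * (norm h)\<^sup>2 * norm k)"
    let ?z = "v + t *\<^sub>R h"
    have a1: "\<bar>f (?z + t *\<^sub>R k) - f ?z - t * (g ?z \<bullet> k) - 1 / 2 * t\<^sup>2 * ((H ?z *v k) \<bullet> k)\<bar> \<le> t ^ 3 * (L / 3 * norm k ^ 3)"
      using taylor[of "?z + t *\<^sub>R k" ?z] t
      by (simp add: matrix_vector_mult_scaleR power_mult_distrib power2_eq_square algebra_simps)
    have a2: "\<bar>f (?z - t *\<^sub>R k) - f ?z + t * (g ?z \<bullet> k) - 1 / 2 * t\<^sup>2 * ((H ?z *v k) \<bullet> k)\<bar> \<le> t ^ 3 * (L / 3 * norm k ^ 3)"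
      using taylor[of "?z - t *\<^sub>R k" ?z] t
      by (simp add: matrix_vector_mult_scaleR vec.neg vec.scale power_mult_distrib power2_eq_square algebra_simps)
    have b: "\<bar>f (v + t *\<^sub>R e) - f v - t * (g v \<bullet> e) - 1 / 2 * t\<^sup>2 * ((H v *v e) \<bullet> e)\<bar> \<le> t ^ 3 * (L / 3 * norm e ^ 3)" for e
      using taylor[of "v + t *\<^sub>R e" v] t
      by (simp add: matrix_vector_mult_scaleR power_mult_distrib power2_eq_square algebra_simps)
    have b1: "\<bar>f (?z + t *\<^sub>R k) - f v - t * (g v \<bullet> (h + k)) - 1 / 2 * t\<^sup>2 * ((H v *v (h + k)) \<bullet> (h + k))\<bar> \<le> t ^ 3 * (L / 3 * norm (h + k) ^ 3)"
      using b[of "h + k"] by (simp add: scaleR_add_right add.assoc)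
    have b2: "\<bar>f (?z - t *\<^sub>R k) - f v - t * (g v \<bullet> (h - k)) - 1 / 2 * t\<^sup>2 * ((H v *v (h - k)) \<bullet> (h - k))\<bar> \<le> t ^ 3 * (L / 3 * norm (h - k) ^ 3)"
      using b[of "h - k"] by (simp add: scaleR_diff_right add_diff_eq)
    have "\<bar>(g ?z - g v - H v *v (t *\<^sub>R h)) \<bullet> k\<bar> \<le> norm (g ?z - g v - H v *v (t *\<^sub>R h)) * norm k"
      by (rule Cauchy_Schwarz_ineq2)
    also have "\<dots> \<le> (L * (norm (t *\<^sub>R h))\<^sup>2) * norm k"
      using grad[of ?z v] by (intro mult_right_mono) auto
    finally have c: "\<bar>g ?z \<bullet> k - g v \<bullet> k - t * ((H v *v h) \<bullet> k)\<bar> \<le> t\<^sup>2 * (L * (norm h)\<^sup>2 * norm k)"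
      using t by (simp add: matrix_vector_mult_scaleR inner_diff_left power_mult_distrib mult_ac)
    have "t * \<bar>g ?z \<bullet> k - g v \<bullet> k - t * ((H v *v h) \<bullet> k)\<bar> \<le> t * (t\<^sup>2 * (L * (norm h)\<^sup>2 * norm k))"
      using c t by (intro mult_left_mono) auto
    moreover have "t * \<bar>g ?z \<bullet> k - g v \<bullet> k - t * ((H v *v h) \<bullet> k)\<bar>
        = \<bar>t * (g ?z \<bullet> k) - t * (g v \<bullet> k) - t\<^sup>2 * ((H v *v h) \<bullet> k)\<bar>"
      using t abs_mult_pos'[of t "g ?z \<bullet> k - g v \<bullet> k - t * ((H v *v h) \<bullet> k)"]
      by (simp add: algebra_simps power2_eq_square)
    ultimately have c': "\<bar>t * (g ?z \<bullet> k) - t * (g v \<bullet> k) - t\<^sup>2 * ((H v *v h) \<bullet> k)\<bar> \<le> t ^ 3 * (L * (norm h)\<^sup>2 * norm k)"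
      by (simp add: power2_eq_square power3_eq_cube mult_ac)
    have e1: "(H v *v (h + k)) \<bullet> (h + k) - (H v *v (h - k)) \<bullet> (h - k) = 2 * ((H v *v h) \<bullet> k + (H v *v k) \<bullet> h)"
      by (simp add: matrix_vector_mult_add_rdistrib matrix_vector_right_distrib matrix_vector_mult_diff_distrib
           inner_add_left inner_add_right inner_diff_left inner_diff_right)
    have "1 / 2 * t\<^sup>2 * ((H v *v (h + k)) \<bullet> (h + k)) - 1 / 2 * t\<^sup>2 * ((H v *v (h - k)) \<bullet> (h - k))
        = t\<^sup>2 * ((H v *v h) \<bullet> k) + t\<^sup>2 * ((H v *v k) \<bullet> h)"
      unfolding right_diff_distrib[symmetric] e1 by (simp add: algebra_simps)
    moreover have "t * (g v \<bullet> (h + k)) - t * (g v \<bullet> (h - k)) = 2 * (t * (g v \<bullet> k))"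
      by (simp add: inner_add_right inner_diff_right algebra_simps)
    ultimately have "t\<^sup>2 * ((H v *v h) \<bullet> k) - t\<^sup>2 * ((H v *v k) \<bullet> h) \<le>
       2 * (t ^ 3 * (L / 3 * norm k ^ 3)) + t ^ 3 * (L / 3 * norm (h + k) ^ 3)
       + t ^ 3 * (L / 3 * norm (h - k) ^ 3) + 2 * (t ^ 3 * (L * (norm h)\<^sup>2 * norm k))"
      using a1 a2 b1 b2 c' by linarith
    also have "\<dots> = t ^ 3 * K"
      by (simp add: K_def algebra_simps)
    finally have "t\<^sup>2 * ((H v *v h) \<bullet> k - (H v *v k) \<bullet> h) \<le> t\<^sup>2 * (t * K)"
      by (simp add: algebra_simps power2_eq_square power3_eq_cube)
    then show "(H v *v h) \<bullet> k - (H v *v k) \<bullet> h \<le> t * K"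
      using t by simp
  qed
  show ?thesis using *[of h k] *[of k h] by simp
qed

lemma directional_difference_quotient:
  fixes F :: "'a :: real_normed_vector \<Rightarrow> real"
  assumes D: "(F has_derivative F') (at d)"
  shows "((\<lambda>t. (F (d + t *\<^sub>R h) - F d) / t) \<longlongrightarrow> F' h) (at_right 0)"
proof -
  have lin: "F' (t *\<^sub>R h) = F' h * t" for t
    using D has_derivative_linear linear_cmul by fastforce
  have "((\<lambda>t. F (d + t *\<^sub>R h)) has_derivative (\<lambda>t. F' (t *\<^sub>R h))) (at 0)"
    by (rule has_derivative_compose[where f = "\<lambda>t. d + t *\<^sub>R h" and x = 0 and g = F, simplified])
      (use D in \<open>auto intro!: derivative_eq_intros\<close>)
  then have "((\<lambda>t. F (d + t *\<^sub>R h)) has_real_derivative F' h) (at 0)"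
    unfolding has_field_derivative_def lin .
  then show ?thesis
    unfolding has_field_derivative_iff
    by (auto intro: tendsto_mono[OF at_le])
qed

text \<open>
  Convexity bounds every forward difference quotient along \<open>u - v\<close> by \<open>f u - f v\<close>, hence also
  their limit.
\<close>

lemma convex_gradient_inequality:
  fixes f :: "real ^ 'n \<Rightarrow> real"
  assumes conv: "convex_on UNIV f" and D: "GDERIV f v :> g"
  shows "f v + g \<bullet> (u - v) \<le> f u"
proof -
  have "((\<lambda>t. (f (v + t *\<^sub>R (u - v)) - f v) / t) \<longlongrightarrow> g \<bullet> (u - v)) (at_right 0)"
    using directional_difference_quotient[of f "\<lambda>h. h \<bullet> g" v "u - v"] D
    by (simp add: gderiv_def inner_commute)
  moreover have "\<forall>\<^sub>F t in at_right 0. (f (v + t *\<^sub>R (u - v)) - f v) / t \<le> f u - f v"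
    unfolding eventually_at_right_field
  proof (intro exI[of _ "1::real"] conjI allI impI)
    fix t :: real assume t: "0 < t" "t < 1"
    have "f ((1 - t) *\<^sub>R v + t *\<^sub>R u) \<le> (1 - t) * f v + t * f u"
      using convex_onD[OF conv, of t v u] t by simp
    then have "f (v + t *\<^sub>R (u - v)) - f v \<le> (f u - f v) * t"
      by (simp add: algebra_simps)
    then show "(f (v + t *\<^sub>R (u - v)) - f v) / t \<le> f u - f v"
      using t by (simp add: pos_divide_le_eq)
  qed simp
  ultimately have "g \<bullet> (u - v) \<le> f u - f v"
    by (rule tendsto_upperbound) simp
  then show ?thesis by simp
qed

text \<open>
  The graph lies above its tangent plane, so at order \<open>t\<^sup>2\<close> the quadratic term cannot be negative.
\<close>

lemma taylor_quadratic_term_nonneg: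
  fixes f :: "real ^ 'n \<Rightarrow> real" and A :: "real ^ 'n ^ 'n"
  assumes above: "\<And>u. f v + g \<bullet> (u - v) \<le> f u"
    and taylor: "\<And>u. \<bar>f u - f v - g \<bullet> (u - v) - 1 / 2 * ((A *v (u - v)) \<bullet> (u - v))\<bar>
                     \<le> M * norm (u - v) ^ 3"
  shows "0 \<le> (A *v h) \<bullet> h"
proof -
  have "- ((A *v h) \<bullet> h) \<le> 0"
  proof (rule nonpos_if_le_small_multiples)
    fix t :: real assume t: "0 < t" "t < 1"
    have "\<bar>f (v + t *\<^sub>R h) - f v - t * (g \<bullet> h) - 1 / 2 * t\<^sup>2 * ((A *v h) \<bullet> h)\<bar> \<le> t ^ 3 * (M * norm h ^ 3)"
      using taylor[of "v + t *\<^sub>R h"] t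
      by (simp add: matrix_vector_mult_scaleR power_mult_distrib power2_eq_square algebra_simps)
    moreover have "f v + t * (g \<bullet> h) \<le> f (v + t *\<^sub>R h)"
      using above[of "v + t *\<^sub>R h"] by simp
    ultimately have "- (1 / 2 * t\<^sup>2 * ((A *v h) \<bullet> h)) \<le> t ^ 3 * (M * norm h ^ 3)"
      by linarith
    then have "t\<^sup>2 * (- ((A *v h) \<bullet> h)) \<le> t\<^sup>2 * (t * (2 * M * norm h ^ 3))"
      by (simp add: power2_eq_square power3_eq_cube algebra_simps)
    then show "- ((A *v h) \<bullet> h) \<le> t * (2 * M * norm h ^ 3)"
      using t mult_le_cancel_left_pos[of "t\<^sup>2"] by fastforce
  qed
  then show ?thesis by simp
qed

section \<open>First-order optimality for the regularized model\<close>

lemma l1_norm_le_sqrt_card_norm: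
  fixes d :: "real ^ 'n"
  shows "l1_norm d \<le> sqrt (real CARD('n)) * norm d"
proof -
  have "(\<Sum>i\<in>UNIV. \<bar>d $ i\<bar> * \<bar>1::real\<bar>) \<le> L2_set (\<lambda>i. d $ i) UNIV * L2_set (\<lambda>_ :: 'n. 1) UNIV"
    by (rule L2_set_mult_ineq)
  then show ?thesis
    by (simp add: l1_norm_def norm_vec_def L2_set_def mult.commute)
qed

lemma l1_norm_nonneg: "l1_norm d \<ge> 0"
  by (simp add: l1_norm_def sum_nonneg)

lemma l1_norm_scaleR: "l1_norm (t *\<^sub>R d) = \<bar>t\<bar> * l1_norm d"
  by (simp add: l1_norm_def abs_mult sum_distrib_left)

lemma l1_norm_add_le: "l1_norm (d + e) \<le> l1_norm d + l1_norm e"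
  by (simp add: l1_norm_def sum.distrib[symmetric] sum_mono)

text \<open>
  At \<open>d = 0\<close> the formula gives the zero map, which is the correct derivative because \<open>p > 1\<close>.
  Covering this point spares every later argument a separate case for a vanishing step.
\<close>

lemma has_derivative_norm_powr:
  fixes d :: "'a :: real_inner"
  assumes p: "1 < p"
  shows "((\<lambda>y. norm y powr p) has_derivative (\<lambda>h. p * norm d powr (p - 2) * (d \<bullet> h))) (at d)"
proof (cases "d = 0")
  case False
  have "((\<lambda>y. norm y powr p) has_derivative (\<lambda>h. p * norm d powr (p - 1) * (sgn d \<bullet> h))) (at d)"
    using False has_derivative_norm[OF False]
    by (auto intro!: derivative_eq_intros simp: powr_diff field_simps inner_commute)
  moreover have "p * norm d powr (p - 1) * (sgn d \<bullet> h) = p * norm d powr (p - 2) * (d \<bullet> h)" for h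
    using False by (simp add: sgn_div_norm powr_diff field_simps power2_eq_square)
  ultimately show ?thesis by simp
next
  case True
  have "((\<lambda>h. norm h powr (p - 1)) \<longlongrightarrow> 0) (at (0::'a))"
    using p by (auto intro!: tendsto_eq_intros tendsto_powr'[where b = "p - 1"])
  moreover have "norm h powr (p - 1) = norm h powr p / norm h" for h :: 'a
    by (cases "h = 0") (auto simp: powr_diff)
  ultimately show ?thesis
    using True p by (simp add: has_derivative_at)
qed

text \<open>
  First-order condition for a sum of a smooth and a nonsmooth term in terms of directions rather
  than subgradients: \<open>c\<close> is any upper bound for the slope of \<open>N\<close> in direction \<open>h\<close>.
\<close>

lemma one_sided_optimality:
  fixes \<psi> N :: "'a :: real_normed_vector \<Rightarrow> real"
  assumes D: "(\<psi> has_derivative \<psi>') (at d)"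
    and min: "\<And>y. \<psi> d + \<rho> * N d \<le> \<psi> y + \<rho> * N y"
    and N: "\<And>t. 0 < t \<Longrightarrow> t < 1 \<Longrightarrow> N (d + t *\<^sub>R h) \<le> N d + t * c"
    and \<rho>: "\<rho> \<ge> 0"
  shows "0 \<le> \<psi>' h + \<rho> * c"
proof -
  have "((\<lambda>t. (\<psi> (d + t *\<^sub>R h) - \<psi> d) / t) \<longlongrightarrow> \<psi>' h) (at_right 0)"
    using D by (rule directional_difference_quotient)
  moreover have "\<forall>\<^sub>F t in at_right 0. - (\<rho> * c) \<le> (\<psi> (d + t *\<^sub>R h) - \<psi> d) / t"
    unfolding eventually_at_right_field
  proof (intro exI[of _ "1::real"] conjI allI impI)
    fix t :: real assume t: "0 < t" "t < 1"
    have "\<rho> * N (d + t *\<^sub>R h) \<le> \<rho> * (N d + t * c)"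
      using N[OF t] \<rho> by (rule mult_left_mono)
    with min[of "d + t *\<^sub>R h"] have "- (\<rho> * c) * t \<le> \<psi> (d + t *\<^sub>R h) - \<psi> d"
      by (simp add: algebra_simps)
    then show "- (\<rho> * c) \<le> (\<psi> (d + t *\<^sub>R h) - \<psi> d) / t"
      using t by (simp add: pos_le_divide_eq)
  qed simp
  ultimately have "- (\<rho> * c) \<le> \<psi>' h"
    by (rule tendsto_lowerbound) simp
  then show ?thesis by simp
qed

context
  fixes g d :: "real ^ 'n" and A :: "real ^ 'n ^ 'n" and p \<mu> \<rho> :: real
  assumes p: "1 < p" and \<rho>: "\<rho> \<ge> 0"
    and sym: "\<And>h k. (A *v h) \<bullet> k = (A *v k) \<bullet> h"
    and min: "\<And>y. g \<bullet> d + 1 / 2 * ((A *v d) \<bullet> d) + \<mu> / p * norm d powr p + \<rho> * l1_norm d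
                 \<le> g \<bullet> y + 1 / 2 * ((A *v y) \<bullet> y) + \<mu> / p * norm y powr p + \<rho> * l1_norm y"
begin

text \<open>
  Symmetry of \<open>A\<close> is what makes \<open>A d\<close> the gradient of \<open>\<langle>A d, d\<rangle> / 2\<close>.
\<close>

lemma model_one_sided_optimality:
  assumes "\<And>t. 0 < t \<Longrightarrow> t < 1 \<Longrightarrow> l1_norm (d + t *\<^sub>R h) \<le> l1_norm d + t * c"
  shows "0 \<le> (g + A *v d + (\<mu> * norm d powr (p - 2)) *\<^sub>R d) \<bullet> h + \<rho> * c"
proof -
  have lin: "((\<lambda>y. A *v y) has_derivative (\<lambda>h. A *v h)) (at d)"
    by (rule bounded_linear_imp_has_derivative) (rule matrix_vector_mul_bounded_linear)
  have "((\<lambda>y. g \<bullet> y + 1 / 2 * ((A *v y) \<bullet> y) + \<mu> / p * norm y powr p) has_derivative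
      (\<lambda>h. g \<bullet> h + 1 / 2 * ((A *v d) \<bullet> h + (A *v h) \<bullet> d) + \<mu> / p * (p * norm d powr (p - 2) * (d \<bullet> h)))) (at d)"
    by (intro has_derivative_add has_derivative_mult_right has_derivative_norm_powr[OF p]
          has_derivative_inner lin has_derivative_inner_right has_derivative_ident)
  from one_sided_optimality[OF this min assms \<rho>, simplified]
  show ?thesis
    using p sym[of d h] by (simp add: inner_add_left)
qed

text \<open>
  Along the ray through \<open>d\<close> the \<open>L\<^sup>1\<close> norm is linear near \<open>d\<close>, so the directions \<open>d\<close> and \<open>-d\<close>
  give opposite inequalities.
\<close>

lemma model_minimizer_along_step:
  "g \<bullet> d + (A *v d) \<bullet> d + \<mu> * norm d powr p + \<rho> * l1_norm d = 0"
proof -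
  let ?v = "g + A *v d + (\<mu> * norm d powr (p - 2)) *\<^sub>R d"
  have "l1_norm (d + t *\<^sub>R d) \<le> l1_norm d + t * l1_norm d" if "0 < t" for t
    using that l1_norm_scaleR[of "1 + t" d] by (simp add: algebra_simps)
  then have 1: "0 \<le> ?v \<bullet> d + \<rho> * l1_norm d"
    by (intro model_one_sided_optimality)
  have "l1_norm (d + t *\<^sub>R (- d)) \<le> l1_norm d + t * (- l1_norm d)" if "0 < t" "t < 1" for t
    using that l1_norm_scaleR[of "1 - t" d] by (simp add: algebra_simps)
  then have 2: "0 \<le> ?v \<bullet> (- d) + \<rho> * (- l1_norm d)"
    by (intro model_one_sided_optimality)
  have "norm d powr (p - 2) * (d \<bullet> d) = norm d powr p"
    by (cases "d = 0") (auto simp: powr_diff dot_square_norm)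
  then have "?v \<bullet> d = g \<bullet> d + (A *v d) \<bullet> d + \<mu> * norm d powr p"
    by (simp add: inner_add_left)
  with 1 2 show ?thesis by simp
qed

text \<open>
  Let \<open>v\<close> be the gradient of the smooth part at \<open>d\<close>; moving in direction \<open>-v\<close> can be compensated
  only by the \<open>L\<^sup>1\<close> term, whose slope is at most \<open>\<rho> \<surd>n \<parallel>v\<parallel>\<close>.
\<close>

lemma model_minimizer_residual:
  "norm (g + A *v d + (\<mu> * norm d powr (p - 2)) *\<^sub>R d) \<le> \<rho> * sqrt (real CARD('n))"
proof -
  define v where "v = g + A *v d + (\<mu> * norm d powr (p - 2)) *\<^sub>R d"
  have "l1_norm (d + t *\<^sub>R (- v)) \<le> l1_norm d + t * l1_norm v" if "0 < t" for t
    using that l1_norm_add_le[of d "t *\<^sub>R (- v)"] l1_norm_scaleR[of "- t" v] by simp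
  then have "0 \<le> v \<bullet> (- v) + \<rho> * l1_norm v"
    unfolding v_def by (intro model_one_sided_optimality)
  then have "norm v * norm v \<le> \<rho> * l1_norm v"
    by (simp add: dot_square_norm power2_eq_square)
  also have "\<dots> \<le> (\<rho> * sqrt (real CARD('n))) * norm v"
    using mult_left_mono[OF l1_norm_le_sqrt_card_norm \<rho>, of v] by (simp add: mult.assoc)
  finally show ?thesis
    using \<rho> unfolding v_def[symmetric] by (cases "v = 0") auto
qed

end

section \<open>One step of the method\<close>

text \<open>
  Here \<open>G\<close> is the gradient norm, \<open>r\<close> the step length, and \<open>w = \<mu> r\<^sup>p\<^sup>-\<^sup>1\<close> the norm of the
  regularization term. With \<open>u = c r\<^sup>2\<close>, the choice of \<open>\<mu>\<close> turns \<open>w\<close> into the weighted geometric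
  mean of \<open>u\<close> and \<open>G\<close> with weights \<open>(p-1)/2\<close> and \<open>(3-p)/2\<close>, which add up to \<open>1\<close>. As \<open>w \<le> G\<close>, also
  \<open>u \<le> G\<close>, and hence \<open>u \<le> w\<close>: the cubic Taylor error is dominated by the regularization.
\<close>

lemma regularized_step_length:
  fixes w r G c \<mu> p :: real
  assumes p: "1 < p" "p \<le> 3" and c: "c > 0" and G: "G > 0" and r: "r \<ge> 0"
    and \<mu>: "\<mu> = c powr ((p - 1) / 2) * G powr ((3 - p) / 2)"
    and bound: "\<mu> * r powr p \<le> G * r"
  defines "w \<equiv> \<mu> * r powr (p - 1)"
  shows "w \<le> G" "c * r\<^sup>2 \<le> w"
    and "w powr (p / (p - 1)) = sqrt c * G powr ((3 - p) / (2 * (p - 1))) * (w * r)"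
proof -
  define u where "u = c * r\<^sup>2"
  have u0: "u \<ge> 0" using c by (simp add: u_def)
  have w_r: "w * r = \<mu> * r powr p"
    using r by (cases "r = 0") (auto simp: w_def powr_diff)
  have \<mu>0: "\<mu> > 0" using \<mu> c G by simp
  have "u powr ((p - 1) / 2) = c powr ((p - 1) / 2) * r powr (p - 1)"
    using r c by (cases "r = 0") (auto simp: u_def powr_mult powr_powr diff_divide_distrib simp flip: powr_numeral)
  then have w_u: "w = u powr ((p - 1) / 2) * G powr ((3 - p) / 2)"
    by (simp add: w_def \<mu>)
  have split: "y = y powr ((p - 1) / 2) * y powr ((3 - p) / 2)" if "y \<ge> 0" for y
    using that by (cases "y = 0") (auto simp: powr_add[symmetric] field_simps)
  show w_le: "w \<le> G"
    using bound G r mult_right_le_imp_le[of w r G] unfolding w_r[symmetric]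
    by (cases "r = 0") (auto simp: w_def)
  have u_le: "u \<le> G"
  proof (rule ccontr)
    assume "\<not> u \<le> G"
    then have "G powr ((p - 1) / 2) < u powr ((p - 1) / 2)"
      using G p by (intro powr_less_mono2) auto
    then have "G powr ((p - 1) / 2) * G powr ((3 - p) / 2) < w"
      unfolding w_u using G by (intro mult_strict_right_mono) auto
    with split[of G] G w_le show False by simp
  qed
  have "u = u powr ((p - 1) / 2) * u powr ((3 - p) / 2)"
    using split u0 by simp
  also have "\<dots> \<le> w"
    unfolding w_u using u0 u_le p by (intro mult_left_mono powr_mono2) auto
  finally show "c * r\<^sup>2 \<le> w" by (simp add: u_def)
  have "w powr (1 / (p - 1)) = u powr (1 / 2) * G powr ((3 - p) / (2 * (p - 1)))"
  proof -
    have "(p - 1) / 2 * (1 / (p - 1)) = 1 / 2" "(3 - p) / 2 * (1 / (p - 1)) = (3 - p) / (2 * (p - 1))"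
      using p by (simp_all add: divide_simps)
    then show ?thesis
      unfolding w_u using u0 G by (simp only: powr_mult powr_powr powr_ge_zero)
  qed
  also have "u powr (1 / 2) = sqrt c * r"
    using c r by (simp add: u_def powr_half_sqrt real_sqrt_mult)
  finally have *: "w powr (1 / (p - 1)) = sqrt c * r * G powr ((3 - p) / (2 * (p - 1)))" .
  have "p / (p - 1) = 1 + 1 / (p - 1)" using p by (simp add: field_simps)
  then have "w powr (p / (p - 1)) = w * w powr (1 / (p - 1))"
    using \<mu>0 r by (auto simp: powr_add w_def)
  then show "w powr (p / (p - 1)) = sqrt c * G powr ((3 - p) / (2 * (p - 1))) * (w * r)"
    unfolding * by (simp add: mult_ac)
qed

text \<open>
  With \<open>G\<close>, \<open>r\<close>, \<open>w\<close> as in \<open>regularized_step_length\<close>: stationarity along \<open>d\<close>,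
  inserted into the Taylor expansion of \<open>f\<close>, leaves a decrease of at least
  \<open>w r - L r\<^sup>3/3 \<ge> 2/3 w r\<close>. The residual bound and the Taylor error give a new gradient of norm at
  most \<open>2 w + q G\<close>. If that norm is at least \<open>\<theta> G\<close>, then \<open>w \<ge> (\<theta> - q) G / 2\<close>; expressing \<open>w r\<close>
  through \<open>w\<close> and \<open>G\<close> makes the powers of \<open>G\<close> combine to \<open>3/2\<close> for every \<open>p\<close>.
\<close>

lemma grnm_step:
  fixes f :: "real ^ 'n \<Rightarrow> real" and x d :: "real ^ 'n"
  assumes convex: "convex_on UNIV f" and smooth: "C2 f"
    and p: "1 < p" "p \<le> 3"
    and min: "is_arg_min (grnm_model f p \<mu> \<rho> x) (\<lambda>_. True) d"
    and nz: "gradient f x \<noteq> 0" and L: "L > 0" "c \<ge> L"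
    and grad: "\<And>u v. norm (gradient f u - gradient f v - hessian f v *v (u - v)) \<le> L * (norm (u - v))\<^sup>2"
    and taylor: "\<And>u v. \<bar>f u - f v - gradient f v \<bullet> (u - v)
                - 1 / 2 * ((hessian f v *v (u - v)) \<bullet> (u - v))\<bar> \<le> L / 3 * norm (u - v) ^ 3"
    and \<mu>: "\<mu> = c powr ((p - 1) / 2) * norm (gradient f x) powr ((3 - p) / 2)"
    and \<rho>: "0 \<le> \<rho>" "\<rho> * sqrt (real CARD('n)) \<le> q * norm (gradient f x)"
  shows "f (x + d) \<le> f x"
    and "norm (gradient f (x + d)) \<le> (2 + q) * norm (gradient f x)"
    and "q \<le> \<theta> \<Longrightarrow> \<theta> * norm (gradient f x) \<le> norm (gradient f (x + d)) \<Longrightarrow>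
           2 / 3 * ((\<theta> - q) / 2) powr (p / (p - 1)) / sqrt c * norm (gradient f x) powr (3 / 2)
             \<le> f x - f (x + d)"
proof -
  define g A G r where "g = gradient f x" and "A = hessian f x" and "G = norm g" and "r = norm d"
  define w where "w = \<mu> * r powr (p - 1)"
  have above: "f v + gradient f v \<bullet> (u - v) \<le> f u" for u v
    using smooth by (intro convex_gradient_inequality convex GDERIV_gradient) (simp add: C2_def)
  have psd: "0 \<le> (A *v h) \<bullet> h" for h
    unfolding A_def by (rule taylor_quadratic_term_nonneg[OF above taylor])
  have sym: "(A *v h) \<bullet> k = (A *v k) \<bullet> h" for h k
    unfolding A_def by (rule taylor_quadratic_term_symmetric[OF grad taylor])
  have min': "g \<bullet> d + 1 / 2 * ((A *v d) \<bullet> d) + \<mu> / p * norm d powr p + \<rho> * l1_norm d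
                 \<le> g \<bullet> y + 1 / 2 * ((A *v y) \<bullet> y) + \<mu> / p * norm y powr p + \<rho> * l1_norm y" for y
    using min by (simp add: is_arg_min_linorder grnm_model_def g_def A_def)
  note along = model_minimizer_along_step[OF p(1) \<rho>(1) sym min']
  note residual = model_minimizer_residual[OF p(1) \<rho>(1) sym min']
  have G: "G > 0" and r: "r \<ge> 0" using nz by (simp_all add: G_def g_def r_def)
  have c: "c > 0" using L by simp
  have \<mu>': "\<mu> = c powr ((p - 1) / 2) * G powr ((3 - p) / 2)" by (simp add: \<mu> G_def g_def)
  have \<mu>0: "\<mu> > 0" using \<mu>' c G by simp
  have l1: "0 \<le> \<rho> * l1_norm d" using \<rho>(1) l1_norm_nonneg[of d] by simp
  have "- (g \<bullet> d) \<le> G * r"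
    using norm_cauchy_schwarz[of "- g" d] by (simp add: G_def r_def)
  then have bound: "\<mu> * r powr p \<le> G * r"
    using along psd[of d] l1 by (simp add: r_def)
  note scalars = regularized_step_length[OF p c G r \<mu>' bound, folded w_def]
  have w0: "w \<ge> 0" using \<mu>0 by (simp add: w_def)
  have w_r: "w * r = \<mu> * r powr p"
    using r by (cases "r = 0") (auto simp: w_def powr_diff)
  have Lr: "L * r\<^sup>2 \<le> w"
    using scalars(2) mult_right_mono[OF L(2), of "r\<^sup>2"] by simp
  have Lr3: "L / 3 * r ^ 3 \<le> w * r / 3"
    using mult_right_mono[OF Lr r] by (simp add: power2_eq_square power3_eq_cube)
  have "f (x + d) - f x \<le> g \<bullet> d + 1 / 2 * ((A *v d) \<bullet> d) + L / 3 * r ^ 3"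
    using abs_le_D1[OF taylor[of "x + d" x]] by (simp add: g_def A_def r_def)
  then have decrease: "2 / 3 * (w * r) \<le> f x - f (x + d)"
    using along psd[of d] l1 Lr3 w_r by (simp add: r_def)
  then show "f (x + d) \<le> f x"
    using mult_nonneg_nonneg[OF w0 r] by linarith
  let ?e = "gradient f (x + d) - g - A *v d"
  let ?v = "g + A *v d + (\<mu> * norm d powr (p - 2)) *\<^sub>R d"
  have "norm ((\<mu> * norm d powr (p - 2)) *\<^sub>R d) = w"
    using \<mu>0 by (cases "d = 0") (auto simp: w_def r_def powr_diff power2_eq_square)
  moreover have "norm ?e \<le> w"
    using grad[of "x + d" x] Lr by (simp add: g_def A_def r_def)
  moreover have "norm ?v \<le> q * G"
    using residual \<rho>(2) by (simp add: G_def g_def)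
  moreover have "gradient f (x + d) = ?e + ?v - (\<mu> * norm d powr (p - 2)) *\<^sub>R d"
    by simp
  ultimately have next_grad: "norm (gradient f (x + d)) \<le> 2 * w + q * G"
    using norm_triangle_ineq4[of "?e + ?v" "(\<mu> * norm d powr (p - 2)) *\<^sub>R d"] norm_triangle_ineq[of ?e ?v]
    by simp
  then show "norm (gradient f (x + d)) \<le> (2 + q) * norm (gradient f x)"
    using scalars(1) by (simp add: G_def g_def algebra_simps)
  assume \<theta>: "q \<le> \<theta>" and slow: "\<theta> * norm (gradient f x) \<le> norm (gradient f (x + d))"
  let ?s = "p / (p - 1)" and ?e = "(3 - p) / (2 * (p - 1))"
  have "(\<theta> - q) / 2 * G \<le> w"
    using slow next_grad by (simp add: G_def g_def algebra_simps)
  then have "((\<theta> - q) / 2 * G) powr ?s \<le> w powr ?s"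
    using \<theta> G p by (intro powr_mono2) auto
  also have "\<dots> = sqrt c * G powr ?e * (w * r)"
    by (rule scalars(3))
  also have "((\<theta> - q) / 2 * G) powr ?s = ((\<theta> - q) / 2) powr ?s * (G powr (3 / 2) * G powr ?e)"
  proof -
    have "?s = 3 / 2 + ?e" using p by (simp add: field_simps)
    then have "G powr ?s = G powr (3 / 2) * G powr ?e" by (simp add: powr_add)
    then show ?thesis using \<theta> G powr_mult[of "(\<theta> - q) / 2" G ?s] by simp
  qed
  finally have "G powr ?e * (((\<theta> - q) / 2) powr ?s * G powr (3 / 2)) \<le> G powr ?e * (sqrt c * (w * r))"
    by (simp only: mult_ac)
  then have "((\<theta> - q) / 2) powr ?s * G powr (3 / 2) \<le> sqrt c * (w * r)"
    using G by simp
  then have "((\<theta> - q) / 2) powr ?s * G powr (3 / 2) / sqrt c \<le> w * r"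
    using c by (simp add: pos_divide_le_eq mult_ac)
  then show "2 / 3 * ((\<theta> - q) / 2) powr ?s / sqrt c * norm (gradient f x) powr (3 / 2) \<le> f x - f (x + d)"
    using decrease unfolding G_def g_def by simp
qed

section \<open>Rates from counting slow steps\<close>

text \<open>
  The recursion \<open>a - b \<ge> \<tau> a\<^sup>3\<^sup>/\<^sup>2\<close> is a discrete form of \<open>y' = -\<tau> y\<^sup>3\<^sup>/\<^sup>2\<close>, along which \<open>1/\<surd>y\<close> grows at
  speed \<open>\<tau>/2\<close>. Since \<open>b \<ge> 0\<close>, it also forces \<open>\<tau> \<surd>a \<le> 1\<close>.
\<close>

lemma inverse_sqrt_step:
  fixes a b \<tau> :: real
  assumes "0 < b" "b \<le> a" "\<tau> > 0" and dec: "\<tau> * a powr (3 / 2) \<le> a - b"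
  shows "1 / sqrt a + \<tau> / 2 \<le> 1 / sqrt b" "\<tau> \<le> 1 / sqrt a"
proof -
  define y z where "y = sqrt a" and "z = sqrt b"
  have pos: "0 < z" "z \<le> y" "0 < y" "a = y\<^sup>2" "b = z\<^sup>2"
    using assms by (auto simp: y_def z_def)
  have "a powr (3 / 2) = y ^ 3"
    using pos powr_powr[of y 2 "3/2"] by (simp flip: powr_numeral)
  then have dec': "\<tau> * y ^ 3 \<le> y\<^sup>2 - z\<^sup>2"
    using dec pos by simp
  also have "\<dots> \<le> (y - z) * (2 * y)"
    using zero_le_power2[of "y - z"] by (simp add: algebra_simps power2_eq_square)
  finally have "y * (\<tau> * y\<^sup>2) \<le> y * (2 * (y - z))"
    by (simp add: algebra_simps power2_eq_square power3_eq_cube)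
  then have "\<tau> * y\<^sup>2 \<le> 2 * (y - z)"
    using pos by simp
  moreover have "\<tau> * (y * z) \<le> \<tau> * y\<^sup>2"
    using pos assms by (simp add: power2_eq_square)
  ultimately have "\<tau> * (y * z) \<le> 2 * (y - z)" by linarith
  then show "1 / sqrt a + \<tau> / 2 \<le> 1 / sqrt b"
    using pos unfolding y_def[symmetric] z_def[symmetric] by (simp add: field_simps)
  have "y\<^sup>2 * (\<tau> * y) = \<tau> * y ^ 3"
    by (simp add: power2_eq_square power3_eq_cube)
  then have "y\<^sup>2 * (\<tau> * y) \<le> y\<^sup>2 * 1"
    using dec' zero_le_power2[of z] by linarith
  then show "\<tau> \<le> 1 / sqrt a"
    using pos unfolding y_def[symmetric] by (simp add: field_simps)
qed

lemma card_Suc_lessThan: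
  "card (I \<inter> {..<Suc k}) = card (I \<inter> {..<k}) + (if k \<in> I then 1 else 0)"
  by (simp add: lessThan_Suc)

text \<open>
  Each index of \<open>I\<close> adds \<open>\<tau>/2\<close> to \<open>1/\<surd>\<Delta>\<close>, and by the second part of \<open>inverse_sqrt_step\<close> the value
  is already at least \<open>\<tau>\<close> when the first index of \<open>I\<close> is met; that is where the summand \<open>1\<close> comes
  from.
\<close>

lemma gap_bound_by_count:
  fixes \<Delta> :: "nat \<Rightarrow> real"
  assumes decr: "\<And>k. \<Delta> (Suc k) \<le> \<Delta> k" and \<tau>: "\<tau> > 0"
    and step: "\<And>k. k \<in> I \<Longrightarrow> \<tau> * \<Delta> k powr (3 / 2) \<le> \<Delta> k - \<Delta> (Suc k)"
    and pos: "\<Delta> k > 0" and m: "card (I \<inter> {..<k}) > 0"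
  shows "\<tau> * (1 + card (I \<inter> {..<k}) / 2) \<le> 1 / sqrt (\<Delta> k)"
  using pos m
proof (induction k)
  case (Suc k)
  have pos: "\<Delta> k > 0" using Suc.prems decr[of k] by simp
  have mono: "1 / sqrt (\<Delta> k) \<le> 1 / sqrt (\<Delta> (Suc k))"
    using Suc.prems decr[of k] by (simp add: frac_le)
  show ?case
  proof (cases "k \<in> I")
    case False
    with Suc.IH Suc.prems pos mono show ?thesis
      by (auto simp: card_Suc_lessThan)
  next
    case True
    note s = inverse_sqrt_step[OF Suc.prems(1) decr \<tau> step[OF True]]
    have "\<tau> * (1 + card (I \<inter> {..<k}) / 2) \<le> 1 / sqrt (\<Delta> k)"
      using Suc.IH pos s(2) by (cases "card (I \<inter> {..<k}) > 0") auto
    moreover have "\<tau> * (1 + card (I \<inter> {..<Suc k}) / 2) = \<tau> * (1 + card (I \<inter> {..<k}) / 2) + \<tau> / 2"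
      using True by (simp add: card_Suc_lessThan field_simps)
    ultimately show ?thesis
      using s(1) by linarith
  qed
qed simp

lemma geometric_bound_by_count:
  fixes G :: "nat \<Rightarrow> real"
  assumes G: "\<And>k. G k \<ge> 0" and C: "C \<ge> 0" and \<theta>: "\<theta> \<ge> 0"
    and grow: "\<And>k. G (Suc k) \<le> C * G k"
    and shrink: "\<And>k. k \<notin> I \<Longrightarrow> G (Suc k) \<le> \<theta> * G k"
  shows "G k \<le> C ^ card (I \<inter> {..<k}) * \<theta> ^ (k - card (I \<inter> {..<k})) * G 0"
proof (induction k)
  case (Suc k)
  have le: "card (I \<inter> {..<k}) \<le> k"
    using card_mono[of "{..<k}" "I \<inter> {..<k}"] by simp
  let ?B = "C ^ card (I \<inter> {..<k}) * \<theta> ^ (k - card (I \<inter> {..<k})) * G 0"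
  show ?case
  proof (cases "k \<in> I")
    case True
    have "G (Suc k) \<le> C * ?B"
      using grow[of k] mult_left_mono[OF Suc.IH C] by linarith
    with True show ?thesis by (simp add: card_Suc_lessThan mult_ac)
  next
    case False
    have "G (Suc k) \<le> \<theta> * ?B"
      using shrink[OF False] mult_left_mono[OF Suc.IH \<theta>] by linarith
    with False le show ?thesis by (simp add: card_Suc_lessThan Suc_diff_le mult_ac)
  qed
qed simp

section \<open>Global convergence rate\<close>

theorem theorem1:
  fixes f :: "real ^ 'n \<Rightarrow> real"
    and xstar x0 :: "real ^ 'n"
    and x :: "nat \<Rightarrow> real ^ 'n"
    and \<mu> \<rho> :: "nat \<Rightarrow> real"
    and p L c1 c2 q R \<theta> \<nu> D \<tau> fstar :: real
    and l :: nat
    and I :: "nat set"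
  assumes convex: "convex_on UNIV f"
    and smooth: "C2 f"
    and minimizer: "is_arg_min f (\<lambda>_. True) xstar"
    and fstar: "fstar = f xstar"
    and p: "1 < p" "p \<le> 3"
    and grnm: "grnm_sequence f p \<mu> \<rho> x0 x"
    and grad_nonzero: "\<forall>k. gradient f (x k) \<noteq> 0"
    and A1: "L > 0"
      "\<forall>u v. norm (gradient f u - gradient f v - hessian f v *v (u - v)) \<le> L * (norm (u - v))\<^sup>2"
      "\<forall>u v. \<bar>f u - f v - gradient f v \<bullet> (u - v)
                - 1 / 2 * ((hessian f v *v (u - v)) \<bullet> (u - v))\<bar> \<le> L / 3 * norm (u - v) ^ 3"
    and A2: "c1 \<ge> L" "0 < c2" "c2 < 1" "q \<ge> 0"
      "\<forall>k. \<mu> k = c1 powr ((p - 1) / 2) * norm (gradient f (x k)) powr ((3 - p) / 2)"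
      "\<forall>k. \<rho> k = min (q / sqrt (real CARD('n)) * norm (gradient f (x k)))
                     (c2 * norm (gradient f (x k)) powr ((p + 1) / 2))"
    and A3: "R > 0" "{u. f u \<le> f x0} \<subseteq> cball 0 R"
    and A4: "3 - (1 + q) powr ((3 - p) / (p - 1)) > 0"
    and A5: "1 + 2 * q + (1 + q) powr (2 / (p - 1)) \<ge> 1"
    and A6: "q < \<theta>" "\<theta> < 1" "\<nu> > 0" "l \<ge> 1"
      "\<forall>k\<ge>l. \<theta> ^ k \<le> \<nu> / (real k)\<^sup>2"
      "\<forall>k\<ge>l. ((1 + 2 * q + (1 + q) powr (2 / (p - 1))) * \<theta>) powr (real k / 2) \<le> \<nu> / (real k)\<^sup>2"
    and I: "I = {i. \<theta> * norm (gradient f (x i)) \<le> norm (gradient f (x (Suc i)))}"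
    and D: "D = R + norm xstar"
    and \<tau>: "\<tau> = (\<theta> - q) powr (p / (p - 1)) * (3 - (1 + q) powr ((3 - p) / (p - 1)))
                 / (3 * sqrt c1 * D powr (3 / 2)
                      * (1 + (1 + q) powr ((3 - p) / (p - 1))) powr (p / (p - 1)))"
  shows "(finite I \<longrightarrow>
            (let ihat = last_index I in
              \<forall>k::nat. int k \<ge> max (int l) (ihat + 2) \<longrightarrow>
                f (x k) - fstar
                  \<le> \<theta> powi (- (ihat + 1)) * \<nu> * D * norm (gradient f (x (nat (ihat + 1)))) / (real k)\<^sup>2))
       \<and> (infinite I \<longrightarrow>
            (\<forall>k\<ge>l. f (x k) - fstar
                \<le> max (36 * \<tau> powi (- 2) / (real k + 4)\<^sup>2)
                      (\<nu> * D * norm (gradient f (x 0)) / (real k)\<^sup>2)))"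
proof -
  define C where "C = 1 + 2 * q + (1 + q) powr (2 / (p - 1))"
  define a where "a = (1 + q) powr ((3 - p) / (p - 1))"
  define s where "s = p / (p - 1)"
  define G where "G = (\<lambda>k. norm (gradient f (x k)))"
  define \<Delta> where "\<Delta> = (\<lambda>k. f (x k) - fstar)"
  obtain d where d: "\<And>k. is_arg_min (grnm_model f p (\<mu> k) (\<rho> k) (x k)) (\<lambda>_. True) (d k)"
      "\<And>k. x (Suc k) = x k + d k"
    and \<rho>0: "\<And>k. \<rho> k \<ge> 0" and x0: "x 0 = x0"
    using grnm unfolding grnm_sequence_def by blast
  have \<rho>: "\<rho> k * sqrt (real CARD('n)) \<le> q * G k" for k
  proof -
    have "\<rho> k \<le> q / sqrt (real CARD('n)) * G k"
      using A2(5,6) by (simp add: G_def)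
    then have "\<rho> k * sqrt (real CARD('n)) \<le> q / sqrt (real CARD('n)) * G k * sqrt (real CARD('n))"
      by (rule mult_right_mono) simp
    then show ?thesis by simp
  qed
  have \<theta>: "0 < \<theta>" "q \<le> \<theta>" and c1: "c1 > 0" and q0: "q \<ge> 0"
    using A1(1) A2 A6 by auto
  \<comment> \<open>The estimates of a single step hold with the constant \<open>1\<close> in place of \<open>a\<close>; as \<open>1 \<le> a < 3\<close>,
    passing to \<open>a\<close> only decreases \<open>\<tau>\<close>.\<close>
  have a1: "a \<ge> 1"
    unfolding a_def using p q0 by (intro ge_one_powr_ge_zero) auto
  have "1 \<le> (1 + q) powr (2 / (p - 1))"
    using p q0 by (intro ge_one_powr_ge_zero) auto
  then have C: "2 + q \<le> C" "1 \<le> C" using q0 by (auto simp: C_def)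
  have D0: "D > 0" using A3(1) norm_ge_zero[of xstar] by (simp add: D del: norm_ge_zero)
  note step = grnm_step[OF convex smooth p d(1) grad_nonzero[rule_format] A1(1) A2(1)
      A1(2)[rule_format] A1(3)[rule_format] A2(5)[rule_format] \<rho>0 \<rho>[unfolded G_def], folded d(2)]
  have G0: "G k > 0" for k using grad_nonzero by (simp add: G_def)
  have grow: "G (Suc k) \<le> C * G k" for k
    using step(2)[of k] mult_right_mono[OF C(1) norm_ge_zero, of "gradient f (x k)"] by (simp add: G_def)
  have shrink: "G (Suc k) \<le> \<theta> * G k" if "k \<notin> I" for k
    using that by (simp add: I G_def)
  have "f (x k) \<le> f x0" for k
    by (induction k) (use step(1) x0 in \<open>auto intro: order_trans\<close>)
  then have in_ball: "norm (x k) \<le> R" for k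
    using A3(2) by (auto simp: subset_iff)
  have gap: "\<Delta> k \<le> D * G k" for k
  proof -
    have "f (x k) + gradient f (x k) \<bullet> (xstar - x k) \<le> fstar"
      unfolding fstar using smooth
      by (intro convex_gradient_inequality convex GDERIV_gradient) (simp add: C2_def)
    then have "\<Delta> k \<le> gradient f (x k) \<bullet> (x k - xstar)"
      by (simp add: \<Delta>_def inner_diff_right)
    also have "\<dots> \<le> G k * norm (x k - xstar)"
      unfolding G_def by (rule norm_cauchy_schwarz)
    also have "\<dots> \<le> G k * D"
      using in_ball[of k] norm_triangle_ineq4[of "x k" xstar] G0[of k]
      by (intro mult_left_mono) (auto simp: D)
    finally show ?thesis by (simp add: mult.commute)
  qed
  have \<Delta>_nonneg: "\<Delta> k \<ge> 0" for k
    using minimizer by (simp add: \<Delta>_def fstar is_arg_min_linorder)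
  have decr: "\<Delta> (Suc k) \<le> \<Delta> k" for k
    using step(1) by (simp add: \<Delta>_def)

  have a3: "a < 3" using A4 by (simp add: a_def)
  have \<tau>_def: "\<tau> = (\<theta> - q) powr s * (3 - a) / (3 * sqrt c1 * D powr (3 / 2) * (1 + a) powr s)"
    by (simp add: \<tau> a_def s_def)
  have \<tau>0: "\<tau> > 0"
    unfolding \<tau>_def using A6(1) a1 a3 c1 D0 by (auto intro!: divide_pos_pos mult_pos_pos)
  have drop: "\<tau> * \<Delta> k powr (3 / 2) \<le> \<Delta> k - \<Delta> (Suc k)" if "k \<in> I" for k
  proof -
    have "\<Delta> k powr (3 / 2) \<le> (D * G k) powr (3 / 2)"
      using gap \<Delta>_nonneg by (intro powr_mono2) auto
    then have "\<tau> * \<Delta> k powr (3 / 2) \<le> \<tau> * (D powr (3 / 2) * G k powr (3 / 2))"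
      using \<tau>0 D0 G0[of k] by (simp add: powr_mult)
    also have "\<dots> = (3 - a) / 3 * ((\<theta> - q) / (1 + a)) powr s / sqrt c1 * G k powr (3 / 2)"
    proof -
      have "D powr (3 / 2) \<noteq> 0" using D0 by simp
      then show ?thesis
        using a1 A6(1) by (simp add: \<tau>_def powr_divide divide_simps)
    qed
    also have "\<dots> \<le> 2 / 3 * ((\<theta> - q) / 2) powr s / sqrt c1 * G k powr (3 / 2)"
      using a1 a3 c1 A6(1) p
      by (intro mult_right_mono divide_right_mono mult_mono powr_mono2 divide_left_mono)
        (auto simp: s_def)
    also have "\<dots> \<le> \<Delta> k - \<Delta> (Suc k)"
      using step(3)[OF \<theta>(2), of k] that by (simp add: \<Delta>_def G_def I s_def)
    finally show ?thesis .
  qed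

  have finite_case: "f (x k) - fstar
      \<le> \<theta> powi (- (ihat + 1)) * \<nu> * D * norm (gradient f (x (nat (ihat + 1)))) / (real k)\<^sup>2"
    if fin: "finite I" and ihat: "ihat = last_index I" and k: "int k \<ge> max (int l) (ihat + 2)"
    for ihat k
  proof -
    define j where "j = nat (ihat + 1)"
    \<comment> \<open>For empty \<open>I\<close> this is \<open>j = 0\<close>; in all cases every index from \<open>j\<close> on is a fast step.\<close>
    have j: "ihat + 1 = int j"
      by (simp add: j_def ihat last_index_def)
    have after: "i \<notin> I" if "j \<le> i" for i
      using that j Max_ge[OF fin, of i] by (auto simp: ihat last_index_def split: if_splits)
    have geom: "G (j + n) \<le> \<theta> ^ n * G j" for n
    proof (induction n)
      case (Suc n)
      have "G (Suc (j + n)) \<le> \<theta> * G (j + n)" by (rule shrink) (simp add: after)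
      also have "\<dots> \<le> \<theta> * (\<theta> ^ n * G j)" using Suc \<theta> by simp
      finally show ?case by (simp add: mult_ac)
    qed simp
    have jk: "j \<le> k" "l \<le> k" using k j by auto
    have "G k \<le> \<theta> ^ (k - j) * G j"
      using geom[of "k - j"] jk by simp
    then have "D * G k \<le> D * (\<theta> ^ (k - j) * G j)"
      using D0 by simp
    with gap[of k] have "\<Delta> k \<le> D * (\<theta> ^ (k - j) * G j)"
      by linarith
    also have "\<theta> ^ (k - j) = \<theta> powi (- int j) * \<theta> ^ k"
      using \<theta> jk by (simp add: power_diff power_int_minus field_simps)
    also have "D * (\<theta> powi (- int j) * \<theta> ^ k * G j) \<le> D * (\<theta> powi (- int j) * (\<nu> / (real k)\<^sup>2) * G j)"
      using A6(5) jk D0 G0[of j] \<theta> by (intro mult_left_mono mult_right_mono) auto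
    finally show ?thesis
      unfolding \<Delta>_def j j_def[symmetric] by (simp add: G_def j mult_ac)
  qed

  have infinite_case: "f (x k) - fstar \<le> max (36 * \<tau> powi (- 2) / (real k + 4)\<^sup>2)
                      (\<nu> * D * norm (gradient f (x 0)) / (real k)\<^sup>2)" if k: "k \<ge> l" for k
  proof -
    define m where "m = card (I \<inter> {..<k})"
    have mk: "m \<le> k"
      using card_mono[of "{..<k}" "I \<inter> {..<k}"] by (simp add: m_def)
    \<comment> \<open>With \<open>m\<close> slow steps before \<open>k\<close>: if they are at most half, the fast steps win, and
      otherwise the gap recursion has been applied often enough.\<close>
    consider "\<Delta> k \<le> 0" | "2 * m \<le> k" | "\<Delta> k > 0" "2 * m > k" by linarith
    then show ?thesis
    proof cases
      case 1
      moreover have "0 \<le> 36 * \<tau> powi (- 2) / (real k + 4)\<^sup>2"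
        using \<tau>0 by simp
      ultimately show ?thesis
        unfolding \<Delta>_def by linarith
    next
      case 2
      have "C ^ m * \<theta> ^ (k - m) = C powr m * \<theta> powr (k - m)"
        using C \<theta> by (simp add: powr_realpow)
      also have "\<dots> \<le> C powr (k / 2) * \<theta> powr (k / 2)"
        using C \<theta> A6(2) 2 mk
        by (intro mult_mono powr_mono powr_mono') (auto simp: of_nat_diff)
      also have "\<dots> = (C * \<theta>) powr (k / 2)"
        using C \<theta> by (simp add: powr_mult)
      also have "\<dots> \<le> \<nu> / (real k)\<^sup>2"
        using A6(6) k by (simp add: C_def)
      finally have "C ^ m * \<theta> ^ (k - m) * G 0 \<le> \<nu> / (real k)\<^sup>2 * G 0"
        using G0[of 0] by (intro mult_right_mono) auto
      moreover have "G k \<le> C ^ m * \<theta> ^ (k - m) * G 0"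
        unfolding m_def
        by (rule geometric_bound_by_count) (use G0 C \<theta> grow shrink in \<open>auto intro: less_imp_le\<close>)
      ultimately have "G k \<le> \<nu> / (real k)\<^sup>2 * G 0"
        by (rule order_trans[rotated])
      then have "D * G k \<le> D * (\<nu> / (real k)\<^sup>2 * G 0)"
        using D0 by (intro mult_left_mono) auto
      with gap[of k] show ?thesis
        by (simp add: \<Delta>_def G_def le_max_iff_disj mult_ac)
    next
      case 3
      \<comment> \<open>Already \<open>1 + m/2 \<ge> (k + 4)/4\<close>; the weaker constant is the one in the claim.\<close>
      have "\<tau> * ((k + 4) / 6) \<le> \<tau> * (1 + m / 2)"
        using \<tau>0 3(2) by (intro mult_left_mono) auto
      also have "\<dots> \<le> 1 / sqrt (\<Delta> k)"
        unfolding m_def using 3(2)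
        by (intro gap_bound_by_count decr \<tau>0 drop 3(1)) (auto simp: m_def)
      finally have "(\<tau> * ((k + 4) / 6))\<^sup>2 \<le> (1 / sqrt (\<Delta> k))\<^sup>2"
        using \<tau>0 by (intro power_mono) auto
      also have "\<dots> = 1 / \<Delta> k"
        using 3(1) by (simp add: power_divide)
      finally have "\<Delta> k * (\<tau> * (real k + 4))\<^sup>2 \<le> 36"
        using 3(1) by (simp add: power_divide power_mult_distrib field_simps)
      then have "\<Delta> k \<le> 36 / (\<tau> * (real k + 4))\<^sup>2"
        using \<tau>0 by (simp add: pos_le_divide_eq)
      then show ?thesis
        by (simp add: \<Delta>_def le_max_iff_disj power_int_minus power_mult_distrib divide_inverse mult_ac)
    qed
  qed

  show ?thesis
    using finite_case infinite_case by (auto simp: Let_def)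
qed

end
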